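(* Let $A$ be a positive, almost surely finite random variable. For a real number $\varrho$ and $\lambda\ge 0$ for which $0<\mathbb{E}[A^{\varrho}e^{-\lambda A}]<\infty$, let $A_{\varrho}(\lambda)$ denote a positive random variable with distribution $$\mathbb{P}(A_{\varrho}(\lambda)\in da)=\frac{a^{\varrho}e^{-\lambda a}\,\mathbb{P}(A\in da)}{\mathbb{E}[A^{\varrho}e^{-\lambda A}]}.$$ Let $-\infty<\varrho_{1}<\varrho_{2}<\infty$ and let $\lambda$ be such that $A_{\varrho_1}(\lambda)$ is well defined. Let $Y_{\varrho_{2},\varrho_{1}}(\lambda)$ be a random variable with $$Y_{\varrho_{2},\varrho_{1}}(\lambda)\overset{d}{=}\frac{G_{\varrho_{2}-\varrho_{1}}}{A_{\varrho_{1}}(\lambda)},$$ where $G_{\varrho_2-\varrho_1}$ is a $\mathrm{Gamma}(\varrho_{2}-\varrho_{1},1)$ random variable independent of $A_{\varrho_{1}}(\lambda)$. Then $$A_{\varrho_{2}}\bigl(\lambda+Y_{\varrho_{2},\varrho_{1}}(\lambda)\bigr)\overset{d}{=}A_{\varrho_{1}}(\lambda).$$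
   Context: $\overset{d}{=}$ denotes equality in distribution. $\mathrm{Gamma}(a,1)$ has density $x^{a-1}e^{-x}/\Gamma(a)$ on $(0,\infty)$. The random variable $A_{\varrho_{2}}(\lambda+Y_{\varrho_{2},\varrho_{1}}(\lambda))$ is understood as a mixture: conditionally on $Y_{\varrho_{2},\varrho_{1}}(\lambda)=y$ it has the distribution of $A_{\varrho_{2}}(\lambda+y)$; that is, its law is $\int_0^\infty \mathbb{P}(A_{\varrho_2}(\lambda+y)\in da)\,\mathbb{P}(Y_{\varrho_2,\varrho_1}(\lambda)\in dy)$. *)

theory Defs
  imports "HOL-Probability.Probability"
begin

(* Random variables that are only almost surely finite take values in ereal; the event
   {A = \<infinity>}, which real_of_ereal sends to 0, is null whenever A is a.s. finite. *)

definition tilt_moment :: "'a measure \<Rightarrow> ('a \<Rightarrow> ereal) \<Rightarrow> real \<Rightarrow> real \<Rightarrow> ennreal" where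
  "tilt_moment M A \<rho> l =
     (\<integral>\<^sup>+ \<omega>. ennreal (real_of_ereal (A \<omega>) powr \<rho> * exp (- l * real_of_ereal (A \<omega>))) \<partial>M)"

definition tiltable :: "'a measure \<Rightarrow> ('a \<Rightarrow> ereal) \<Rightarrow> real \<Rightarrow> real \<Rightarrow> bool" where
  "tiltable M A \<rho> l \<longleftrightarrow> 0 \<le> l \<and> 0 < tilt_moment M A \<rho> l \<and> tilt_moment M A \<rho> l < \<infinity>"

(* The law of the tilted variable; meaningful as such only under tiltable. If the moment is
   infinite then, because x / \<infinity> = 0 in ennreal, this is the null measure. *)
definition tilted_law :: "'a measure \<Rightarrow> ('a \<Rightarrow> ereal) \<Rightarrow> real \<Rightarrow> real \<Rightarrow> real measure" where
  "tilted_law M A \<rho> l =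
     density (distr M borel (\<lambda>\<omega>. real_of_ereal (A \<omega>)))
       (\<lambda>a. ennreal (a powr \<rho> * exp (- l * a)) / tilt_moment M A \<rho> l)"

definition gamma_density :: "real \<Rightarrow> real \<Rightarrow> real" where
  "gamma_density a x = (if 0 < x then x powr (a - 1) * exp (- x) / Gamma a else 0)"

definition tilted_mixture ::
  "'a measure \<Rightarrow> ('a \<Rightarrow> ereal) \<Rightarrow> real \<Rightarrow> real \<Rightarrow> real measure \<Rightarrow> real measure" where
  "tilted_mixture M A \<rho> l \<nu> = \<nu> \<bind> (\<lambda>y. tilted_law M A \<rho> (l + y))"

(* bind has its intended meaning only for measurable kernels; the next two lemmas verify this,
   so that tilted_mixture is the integral of the laws of the tilted variables. *)

lemma measurable_tilted_law:
  fixes A :: "'a \<Rightarrow> ereal"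
  assumes "prob_space M" and A: "A \<in> borel_measurable M"
    and pos: "AE \<omega> in M. 0 < A \<omega> \<and> A \<omega> < \<infinity>"
  shows "(\<lambda>y. tilted_law M A \<rho> (l + y)) \<in> borel \<rightarrow>\<^sub>M subprob_algebra borel"
proof -
  interpret prob_space M by fact
  define X where "X = (\<lambda>\<omega>. real_of_ereal (A \<omega>))"
  have X[measurable]: "X \<in> borel_measurable M" unfolding X_def using A by measurable
  interpret D: prob_space "distr M borel X" by (rule prob_space_distr) (rule X)
  have pX: "AE \<omega> in M. 0 < X \<omega>"
    using pos by eventually_elim (auto simp: X_def zero_less_real_of_ereal)
  define f where "f y a = ennreal (a powr \<rho> * exp (- (l + y) * a))" for y a :: real
  have f[measurable]: "case_prod f \<in> borel_measurable (borel \<Otimes>\<^sub>M borel)"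
    unfolding f_def by measurable
  define m where "m y = tilt_moment M A \<rho> (l + y)" for y
  have m_eq0: "m y = (\<integral>\<^sup>+ \<omega>. f y (X \<omega>) \<partial>M)" for y
    by (simp add: m_def tilt_moment_def f_def X_def)
  have m_eq: "m y = (\<integral>\<^sup>+ a. f y a \<partial>distr M borel X)" for y
    unfolding m_eq0 by (subst nn_integral_distr) auto
  have m_pos: "m y \<noteq> 0" for y
  proof
    assume "m y = 0"
    then have "AE \<omega> in M. f y (X \<omega>) = 0"
      unfolding m_eq0 by (subst (asm) nn_integral_0_iff_AE) auto
    with pX have "AE \<omega> in M. False"
      by eventually_elim (auto simp: f_def ennreal_eq_0_iff mult_le_0_iff not_le)
    then show False by simp
  qed
  have [measurable]: "m \<in> borel_measurable borel"
    unfolding m_eq[abs_def]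
    by (rule D.borel_measurable_nn_integral) measurable
  have tl: "tilted_law M A \<rho> (l + y) = density (distr M borel X) (\<lambda>a. f y a / m y)" for y
    by (simp add: tilted_law_def f_def m_def X_def)
  have em: "emeasure (tilted_law M A \<rho> (l + y)) E
      = (\<integral>\<^sup>+ a. f y a / m y * indicator E a \<partial>distr M borel X)" if "E \<in> sets borel" for y E
    unfolding tl using that by (subst emeasure_density) auto
  show ?thesis
  proof (rule measurable_subprob_algebra)
    fix y :: real
    have "emeasure (tilted_law M A \<rho> (l + y)) UNIV = m y / m y"
      by (subst em) (auto simp: m_eq nn_integral_divide)
    also have "\<dots> \<le> 1"
      using m_pos[of y] by (cases "m y = top") (auto simp: ennreal_divide_self less_top)
    finally show "subprob_space (tilted_law M A \<rho> (l + y))"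
      by (intro subprob_spaceI) (auto simp: tl)
    show "sets (tilted_law M A \<rho> (l + y)) = sets borel" by (simp add: tl)
  next
    fix E :: "real set" assume E[measurable]: "E \<in> sets borel"
    show "(\<lambda>y. emeasure (tilted_law M A \<rho> (l + y)) E) \<in> borel_measurable borel"
      unfolding em[OF E] by (rule D.borel_measurable_nn_integral) measurable
  qed
qed

lemma emeasure_tilted_mixture:
  fixes A :: "'a \<Rightarrow> ereal"
  assumes "prob_space M" "A \<in> borel_measurable M" "AE \<omega> in M. 0 < A \<omega> \<and> A \<omega> < \<infinity>"
    and "sets \<nu> = sets borel" "AE y in \<nu>. 0 < y" and "E \<in> sets borel"
  shows "emeasure (tilted_mixture M A \<rho> l \<nu>) E
           = (\<integral>\<^sup>+ y\<in>{0<..}. emeasure (tilted_law M A \<rho> (l + y)) E \<partial>\<nu>)"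
proof -
  have "(\<lambda>y. tilted_law M A \<rho> (l + y)) \<in> \<nu> \<rightarrow>\<^sub>M subprob_algebra borel"
    using measurable_tilted_law[OF assms(1-3)] assms(4) by (simp cong: measurable_cong_sets)
  moreover have "space \<nu> \<noteq> {}"
    using sets_eq_imp_space_eq[OF assms(4)] by simp
  ultimately have "emeasure (tilted_mixture M A \<rho> l \<nu>) E
      = (\<integral>\<^sup>+ y. emeasure (tilted_law M A \<rho> (l + y)) E \<partial>\<nu>)"
    unfolding tilted_mixture_def using assms(6) by (intro emeasure_bind)
  also have "\<dots> = (\<integral>\<^sup>+ y\<in>{0<..}. emeasure (tilted_law M A \<rho> (l + y)) E \<partial>\<nu>)"
    using assms(5) by (intro nn_integral_cong_AE) auto
  finally show ?thesis .
qed

end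

theory Submission imports Defs begin

text \<open>
  The identity is Bayes' rule for the pair \<open>(Y, B)\<close> with \<open>Y = G / B\<close>, where \<open>B\<close> has the law of the
  variable tilted by \<open>(\<rho>1, l)\<close> and \<open>c = \<rho>2 - \<rho>1\<close>. Given \<open>B = a\<close>, the ratio is a Gamma
  variable of rate \<open>a\<close>, with density \<open>y powr (c - 1) * a powr c * exp (- y * a) / Gamma c\<close>.
  Multiplying by the tilt \<open>a powr \<rho>1 * exp (- l * a) / m1\<close> of \<open>B\<close>, with \<open>m1\<close> its
  normalising moment, gives the joint density of \<open>(Y, B)\<close> with respect to Lebesgue measure
  times the law of \<open>A\<close>:

  \<open>y powr (c - 1) / Gamma c * (a powr \<rho>2 * exp (- (l + y) * a)) / m1\<close>  for \<open>y > 0\<close>.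

  As a function of \<open>a\<close> this is proportional to the tilt by \<open>(\<rho>2, l + y)\<close>. Hence that tilted
  law is the conditional law of \<open>B\<close> given \<open>Y = y\<close>, and averaging it over the law of \<open>Y\<close>
  returns the law of \<open>B\<close>. The joint density comes from \<open>nn_integral_gamma_ratio\<close>.

  Integrating out \<open>a\<close> shows that \<open>Y\<close> has a density proportional to \<open>y powr (c - 1)\<close> times the
  moment of order \<open>\<rho>2\<close> at \<open>l + y\<close>. A probability density is finite almost everywhere, so
  this moment is finite for almost every \<open>y > 0\<close>; that is why the tilted variable at the random
  parameter \<open>l + Y\<close> is almost surely well defined, even when it is not defined at \<open>l\<close> itself.
\<close>

text \<open>
  The part of the conditional density of the ratio that does not involve the divisor. It is kept
  apart because the remaining factor is what combines with the tilt.
\<close>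

definition gamma_weight :: "real \<Rightarrow> real \<Rightarrow> ennreal" where
  "gamma_weight c y = ennreal (y powr (c - 1) / Gamma c) * indicator {0<..} y"

lemma measurable_gamma_weight [measurable]: "gamma_weight c \<in> borel_measurable borel"
  unfolding gamma_weight_def by measurable

lemma measurable_gamma_density [measurable]: "gamma_density c \<in> borel_measurable borel"
  unfolding gamma_density_def by measurable

lemma gamma_weight_nonzero_iff:
  assumes "0 < c"
  shows "gamma_weight c y \<noteq> 0 \<longleftrightarrow> 0 < y"
  using assms by (auto simp: gamma_weight_def ennreal_eq_0_iff not_le indicator_def Gamma_real_pos)

text \<open>The extra factor \<open>a\<close> is the Jacobian of the substitution \<open>g = a * y\<close>.\<close>

lemma gamma_density_scaled:
  assumes "0 < a" "0 < c"
  shows "ennreal a * ennreal (gamma_density c (a * y))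
       = gamma_weight c y * ennreal (a powr c * exp (- y * a))"
proof (cases "0 < y")
  case True
  have "a * gamma_density c (a * y) = y powr (c - 1) / Gamma c * (a powr c * exp (- y * a))"
    using assms True by (simp add: gamma_density_def powr_mult powr_diff mult_ac)
  then show ?thesis
    using True assms
    by (simp add: gamma_weight_def ennreal_mult[symmetric] Gamma_real_pos less_imp_le
        gamma_density_def)
next
  case False
  then show ?thesis
    using assms by (simp add: gamma_weight_def gamma_density_def zero_less_mult_iff)
qed

lemma nn_integral_gamma_density_divide:
  fixes h :: "real \<Rightarrow> ennreal"
  assumes "0 < a" "0 < c" and [measurable]: "h \<in> borel_measurable borel"
  shows "(\<integral>\<^sup>+ g. ennreal (gamma_density c g) * h (g / a) \<partial>lborel)
       = (\<integral>\<^sup>+ y. gamma_weight c y * ennreal (a powr c * exp (- y * a)) * h y \<partial>lborel)"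
proof -
  have "(\<integral>\<^sup>+ g. ennreal (gamma_density c g) * h (g / a) \<partial>lborel)
      = ennreal a * (\<integral>\<^sup>+ y. ennreal (gamma_density c (a * y)) * h y \<partial>lborel)"
    using assms(1) by (subst nn_integral_real_affine[where c = a and t = 0]) auto
  also have "\<dots> = (\<integral>\<^sup>+ y. ennreal a * ennreal (gamma_density c (a * y)) * h y \<partial>lborel)"
    by (subst nn_integral_cmult[symmetric]) (auto simp: mult_ac)
  finally show ?thesis
    by (simp only: gamma_density_scaled[OF assms(1,2)])
qed

text \<open>
  By independence one may fix the value \<open>a\<close> of \<open>B\<close>, rescale the Gamma variable by it, and then
  exchange the order of integration by Tonelli's theorem. Allowing test functions of both
  coordinates lets the same formula give the law of the ratio (\<open>f\<close> depending on \<open>y\<close> only) and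
  recover the law of \<open>B\<close> (\<open>f\<close> depending on \<open>a\<close> only).
\<close>

lemma nn_integral_gamma_ratio:
  fixes f :: "real \<Rightarrow> real \<Rightarrow> ennreal" and w :: "real \<Rightarrow> ennreal" and B G :: "'b \<Rightarrow> real"
  assumes "prob_space N" "sigma_finite_measure D"
    and sD[measurable_cong]: "sets D = sets borel"
    and pos: "AE a in D. 0 < a" and c: "0 < c"
    and B[measurable]: "B \<in> borel_measurable N"
    and w[measurable]: "w \<in> borel_measurable borel"
    and dB: "distr N borel B = density D w"
    and dG: "distributed N lborel G (\<lambda>x. ennreal (gamma_density c x))"
    and indep: "prob_space.indep_var N borel G borel B"
    and f[measurable]: "case_prod f \<in> borel_measurable (borel \<Otimes>\<^sub>M borel)"
  shows "(\<integral>\<^sup>+ \<omega>. f (G \<omega> / B \<omega>) (B \<omega>) \<partial>N)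
       = (\<integral>\<^sup>+ y. gamma_weight c y *
            (\<integral>\<^sup>+ a. w a * ennreal (a powr c * exp (- y * a)) * f y a \<partial>D) \<partial>lborel)"
proof -
  interpret N: prob_space N by fact
  interpret D: sigma_finite_measure D by fact
  interpret P: pair_sigma_finite lborel D ..
  have G[measurable]: "G \<in> borel_measurable N"
    using distributed_measurable[OF dG] by simp
  have dG': "distr N borel G = density lborel (\<lambda>x. ennreal (gamma_density c x))"
    using distributed_distr_eq_density[OF dG] by (simp cong: distr_cong)
  interpret LG: prob_space "distr N borel G" by (rule N.prob_space_distr) simp
  interpret LB: prob_space "distr N borel B" by (rule N.prob_space_distr) simp
  interpret L: pair_prob_space "distr N borel G" "distr N borel B" ..
  have joint: "distr N borel G \<Otimes>\<^sub>M distr N borel B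
      = distr N (borel \<Otimes>\<^sub>M borel) (\<lambda>\<omega>. (G \<omega>, B \<omega>))"
    using indep N.indep_var_distribution_eq by blast
  have "(\<integral>\<^sup>+ \<omega>. f (G \<omega> / B \<omega>) (B \<omega>) \<partial>N)
      = (\<integral>\<^sup>+ (g, b). f (g / b) b \<partial>(distr N borel G \<Otimes>\<^sub>M distr N borel B))"
    unfolding joint by (subst nn_integral_distr) auto
  also have "\<dots> = (\<integral>\<^sup>+ b. \<integral>\<^sup>+ g. f (g / b) b \<partial>distr N borel G \<partial>distr N borel B)"
    by (subst L.nn_integral_snd[symmetric]) auto
  also have "\<dots> = (\<integral>\<^sup>+ b. \<integral>\<^sup>+ g. ennreal (gamma_density c g) * f (g / b) b \<partial>lborel \<partial>distr N borel B)"
    unfolding dG' by (intro nn_integral_cong) (simp add: nn_integral_density)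
  also have "\<dots> = (\<integral>\<^sup>+ a. w a * (\<integral>\<^sup>+ g. ennreal (gamma_density c g) * f (g / a) a \<partial>lborel) \<partial>D)"
    unfolding dB by (subst nn_integral_density) auto
  also have "\<dots> = (\<integral>\<^sup>+ a. \<integral>\<^sup>+ y. gamma_weight c y *
      (w a * ennreal (a powr c * exp (- y * a)) * f y a) \<partial>lborel \<partial>D)"
    using pos
  proof (intro nn_integral_cong_AE, eventually_elim)
    case (elim a)
    show ?case
      using elim c
      by (subst nn_integral_gamma_density_divide)
         (auto simp: nn_integral_cmult[symmetric] mult_ac)
  qed
  also have "\<dots> = (\<integral>\<^sup>+ y. \<integral>\<^sup>+ a. gamma_weight c y *
      (w a * ennreal (a powr c * exp (- y * a)) * f y a) \<partial>D \<partial>lborel)"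
    by (intro P.Fubini') measurable
  finally show ?thesis
    by (simp add: nn_integral_cmult)
qed

theorem proposition1p1:
  fixes M :: "'a measure" and A :: "'a \<Rightarrow> ereal"
    and N :: "'b measure" and B G :: "'b \<Rightarrow> real"
    and R :: "'c measure" and Y :: "'c \<Rightarrow> real"
    and \<rho>1 \<rho>2 l :: real
  assumes "prob_space M"
    and "A \<in> borel_measurable M"
    and "AE \<omega> in M. 0 < A \<omega> \<and> A \<omega> < \<infinity>"
    and "\<rho>1 < \<rho>2"
    and "tiltable M A \<rho>1 l"
    and "prob_space N"
    and "B \<in> borel_measurable N"
    and "distr N borel B = tilted_law M A \<rho>1 l"
    and "distributed N lborel G (\<lambda>x. ennreal (gamma_density (\<rho>2 - \<rho>1) x))"
    and "prob_space.indep_var N borel G borel B"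
    and "prob_space R"
    and "Y \<in> borel_measurable R"
    and "distr R borel Y = distr N borel (\<lambda>\<omega>. G \<omega> / B \<omega>)"
  shows "(AE \<omega> in R. tiltable M A \<rho>2 (l + Y \<omega>)) \<and>
         tilted_mixture M A \<rho>2 l (distr R borel Y) = tilted_law M A \<rho>1 l"
proof -
  interpret M: prob_space M by fact
  interpret N: prob_space N by fact
  define c where "c = \<rho>2 - \<rho>1"
  have c: "0 < c" using assms(4) by (simp add: c_def)
  define X where "X = (\<lambda>\<omega>. real_of_ereal (A \<omega>))"
  have X[measurable]: "X \<in> borel_measurable M" unfolding X_def by (rule borel_measurable_real_of_ereal[OF assms(2)])
  have pX: "AE \<omega> in M. 0 < X \<omega>"
    using assms(3) by eventually_elim (auto simp: X_def zero_less_real_of_ereal)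
  define D where "D = distr M borel X"
  have sD[measurable_cong]: "sets D = sets borel" by (simp add: D_def)
  interpret D: prob_space D unfolding D_def by (rule M.prob_space_distr) simp
  have pD: "AE a in D. 0 < a"
    unfolding D_def using pX by (subst AE_distr_iff) auto
  define u where "u y a = ennreal (a powr \<rho>2 * exp (- (l + y) * a))" for y a :: real
  have [measurable]: "case_prod u \<in> borel_measurable (borel \<Otimes>\<^sub>M borel)"
    unfolding u_def by measurable
  define m1 where "m1 = tilt_moment M A \<rho>1 l"
  define m2 where "m2 y = tilt_moment M A \<rho>2 (l + y)" for y
  have l: "0 \<le> l" and m1: "0 < m1" "m1 < \<top>"
    using assms(5) by (auto simp: tiltable_def m1_def)
  have m2_eq: "m2 y = (\<integral>\<^sup>+ a. u y a \<partial>D)" for y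
  proof -
    have "m2 y = (\<integral>\<^sup>+ \<omega>. u y (X \<omega>) \<partial>M)"
      by (simp add: m2_def tilt_moment_def u_def X_def)
    then show ?thesis
      unfolding D_def by (subst nn_integral_distr) auto
  qed
  have m2_pos: "m2 y \<noteq> 0" for y
  proof
    assume "m2 y = 0"
    then have "AE a in D. u y a = 0"
      unfolding m2_eq by (subst (asm) nn_integral_0_iff_AE) auto
    with pD have "AE a in D. False"
      by eventually_elim (auto simp: u_def ennreal_eq_0_iff mult_le_0_iff not_le)
    then show False by simp
  qed
  have m2_meas[measurable]: "m2 \<in> borel_measurable borel"
    unfolding m2_eq[abs_def] by (rule D.borel_measurable_nn_integral) measurable

  have law_B: "distr N borel B = density D (\<lambda>a. ennreal (a powr \<rho>1 * exp (- l * a)) / m1)"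
    using assms(8) by (simp add: tilted_law_def D_def X_def m1_def)
  \<comment> \<open>The joint density of \<open>(G / B, B)\<close>: the tilt by \<open>(\<rho>1, l)\<close> and the factor
    \<open>a powr c * exp (- y * a)\<close> of the Gamma density merge into the tilt \<open>u y\<close>.\<close>
  have joint: "(\<integral>\<^sup>+ \<omega>. f (G \<omega> / B \<omega>) (B \<omega>) \<partial>N)
      = (\<integral>\<^sup>+ y. gamma_weight c y * ((\<integral>\<^sup>+ a. u y a * f y a \<partial>D) / m1) \<partial>lborel)"
    if f[measurable]: "case_prod f \<in> borel_measurable (borel \<Otimes>\<^sub>M borel)" for f
  proof -
    have "(\<integral>\<^sup>+ \<omega>. f (G \<omega> / B \<omega>) (B \<omega>) \<partial>N)
       = (\<integral>\<^sup>+ y. gamma_weight c y *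
            (\<integral>\<^sup>+ a. ennreal (a powr \<rho>1 * exp (- l * a)) / m1
              * ennreal (a powr c * exp (- y * a)) * f y a \<partial>D) \<partial>lborel)"
      by (rule nn_integral_gamma_ratio[OF assms(6) D.sigma_finite_measure_axioms sD pD c
            assms(7) _ law_B assms(9)[folded c_def] assms(10)]) measurable
    also have "\<dots> = (\<integral>\<^sup>+ y. gamma_weight c y * (\<integral>\<^sup>+ a. u y a * f y a / m1 \<partial>D) \<partial>lborel)"
    proof (intro nn_integral_cong arg_cong2[where f = "(*)"] refl)
      fix y a :: real
      have *: "ennreal (a powr \<rho>1 * exp (- l * a)) * ennreal (a powr c * exp (- y * a)) = u y a"
      proof -
        have "a powr \<rho>2 * exp (- (l + y) * a)
            = a powr \<rho>1 * exp (- l * a) * (a powr c * exp (- y * a))"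
          using powr_add[of a \<rho>1 c] exp_add[of "- l * a" "- y * a"]
          by (simp add: c_def algebra_simps)
        then show ?thesis by (simp add: u_def ennreal_mult)
      qed
      show "ennreal (a powr \<rho>1 * exp (- l * a)) / m1
              * ennreal (a powr c * exp (- y * a)) * f y a = u y a * f y a / m1"
        by (simp add: *[symmetric] divide_ennreal_def mult_ac)
    qed
    finally show ?thesis by (simp add: nn_integral_divide)
  qed

  define q where "q y = gamma_weight c y * (m2 y / m1)" for y
  have [measurable]: "q \<in> borel_measurable borel" unfolding q_def by measurable
  have [measurable]: "G \<in> borel_measurable N"
    using distributed_measurable[OF assms(9)] by simp
  have dY: "distr R borel Y = density lborel q"
  proof (rule measure_eqI)
    fix E assume "E \<in> sets (distr R borel Y)"
    then have [measurable]: "E \<in> sets borel" by simp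
    have "emeasure (distr R borel Y) E = (\<integral>\<^sup>+ \<omega>. indicator E (G \<omega> / B \<omega>) \<partial>N)"
      unfolding assms(13) using assms(7)
      by (subst nn_integral_indicator[symmetric], simp, subst nn_integral_distr) auto
    also have "\<dots> = (\<integral>\<^sup>+ y. gamma_weight c y * ((\<integral>\<^sup>+ a. u y a * indicator E y \<partial>D) / m1) \<partial>lborel)"
      by (rule joint[of "\<lambda>y a. indicator E y"]) measurable
    also have "\<dots> = (\<integral>\<^sup>+ y. q y * indicator E y \<partial>lborel)"
      by (intro nn_integral_cong)
         (simp add: nn_integral_multc m2_eq q_def divide_ennreal_def, simp add: mult_ac)
    finally show "emeasure (distr R borel Y) E = emeasure (density lborel q) E"
      by (simp add: emeasure_density)
  qed simp
  \<comment> \<open>Total mass 1 forces \<open>q\<close> to be finite almost everywhere, and with it \<open>m2\<close> on the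
    half-line where the weight does not vanish.\<close>
  have "(\<integral>\<^sup>+ y. q y \<partial>lborel) = emeasure (distr R borel Y) UNIV"
    unfolding dY by (simp add: emeasure_density)
  also have "\<dots> = 1"
    using prob_space.emeasure_space_1[OF prob_space.prob_space_distr[OF assms(11,12)]] by simp
  finally have "AE y in lborel. q y \<noteq> \<infinity>"
    by (intro nn_integral_noteq_infinite) auto
  then have fin: "AE y in lborel. 0 < y \<longrightarrow> m2 y < \<top>"
  proof eventually_elim
    case (elim y)
    show ?case
    proof
      assume "0 < y"
      then have "gamma_weight c y \<noteq> 0" using gamma_weight_nonzero_iff[OF c] by simp
      with elim m1 show "m2 y < \<top>"
        by (cases "m2 y = \<top>") (auto simp: q_def ennreal_top_divide ennreal_mult_top less_top[symmetric])
    qed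
  qed

  have "AE y in distr R borel Y. tiltable M A \<rho>2 (l + y)"
    unfolding dY using fin
  proof (subst AE_density, simp, eventually_elim)
    case (elim y)
    then show ?case
      using l m2_pos[of y] gamma_weight_nonzero_iff[OF c, of y]
      by (auto simp: q_def tiltable_def m2_def zero_less_iff_neq_zero)
  qed
  then have tilt: "AE \<omega> in R. tiltable M A \<rho>2 (l + Y \<omega>)"
    using assms(12) by (rule AE_distrD[rotated])

  have "tilted_mixture M A \<rho>2 l (distr R borel Y) = distr N borel B"
  proof (rule measure_eqI)
    have kern: "(\<lambda>y. tilted_law M A \<rho>2 (l + y)) \<in> distr R borel Y \<rightarrow>\<^sub>M subprob_algebra borel"
      using measurable_tilted_law[OF assms(1-3)] by simp
    show "sets (tilted_mixture M A \<rho>2 l (distr R borel Y)) = sets (distr N borel B)"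
      unfolding tilted_mixture_def by (subst sets_bind[OF sets_kernel[OF kern]]) auto
    fix E assume "E \<in> sets (tilted_mixture M A \<rho>2 l (distr R borel Y))"
    then have E[measurable]: "E \<in> sets borel"
      unfolding tilted_mixture_def by (subst (asm) sets_bind[OF sets_kernel[OF kern]]) auto
    define s where "s y = (\<integral>\<^sup>+ a. u y a * indicator E a \<partial>D)" for y
    have [measurable]: "s \<in> borel_measurable borel"
      unfolding s_def by (rule D.borel_measurable_nn_integral) measurable
    have em: "emeasure (tilted_law M A \<rho>2 (l + y)) E = s y / m2 y" for y
    proof -
      have "tilted_law M A \<rho>2 (l + y) = density D (\<lambda>a. u y a / m2 y)"
        by (simp add: tilted_law_def D_def X_def u_def m2_def)
      then have "emeasure (tilted_law M A \<rho>2 (l + y)) E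
          = (\<integral>\<^sup>+ a. u y a * indicator E a / m2 y \<partial>D)"
        by (simp add: emeasure_density divide_ennreal_def mult_ac)
      then show ?thesis by (simp add: nn_integral_divide s_def)
    qed
    have "emeasure (tilted_mixture M A \<rho>2 l (distr R borel Y)) E
        = (\<integral>\<^sup>+ y. s y / m2 y \<partial>distr R borel Y)"
      unfolding tilted_mixture_def using kern
      by (subst emeasure_bind) (auto simp: em)
    also have "\<dots> = (\<integral>\<^sup>+ y. q y * (s y / m2 y) \<partial>lborel)"
      unfolding dY by (subst nn_integral_density) auto
    \<comment> \<open>The normalisation of the conditional law cancels against the density of \<open>Y\<close>.\<close>
    also have "\<dots> = (\<integral>\<^sup>+ y. gamma_weight c y * (s y / m1) \<partial>lborel)"
      using fin
    proof (intro nn_integral_cong_AE, eventually_elim)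
      case (elim y)
      show ?case
      proof (cases "0 < y")
        case True
        then have "m2 y * inverse (m2 y) = 1"
          using elim m2_pos[of y]
          by (simp add: ennreal_divide_self flip: divide_ennreal_def)
        then have "gamma_weight c y * (s y * inverse m1) * (m2 y * inverse (m2 y))
            = gamma_weight c y * (s y * inverse m1)"
          by simp
        then show ?thesis by (simp add: q_def divide_ennreal_def mult_ac)
      next
        case False
        then show ?thesis using gamma_weight_nonzero_iff[OF c, of y] by (simp add: q_def)
      qed
    qed
    also have "\<dots> = (\<integral>\<^sup>+ \<omega>. indicator E (B \<omega>) \<partial>N)"
      unfolding s_def by (rule joint[of "\<lambda>y a. indicator E a", symmetric]) measurable
    also have "\<dots> = emeasure (distr N borel B) E"
      using assms(7)
      by (subst nn_integral_indicator[symmetric], simp, subst nn_integral_distr) auto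
    finally show "emeasure (tilted_mixture M A \<rho>2 l (distr R borel Y)) E
        = emeasure (distr N borel B) E" .
  qed
  with tilt show ?thesis by (simp add: assms(8))
qed

end
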